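(* Let $L(z)=\frac{1-\sqrt{1-4z}}{2z}$. The bivariate generating function $\mathit{Total}(z,u)$ of partial Łukasiewicz paths read from right to left, where $z$ marks the length and $u$ marks the height of the end point, is $$\mathit{Total}(z,u)=\frac{2}{1-2zu+\sqrt{1-4z}},$$ and for all $k\ge 0$ $$[u^k]\mathit{Total}(z,u)=z^kL(z)^{k+1}.$$ Moreover, for all $n\ge 1$ and $k\ge0$, $$[z^n][u^k]\mathit{Total}(z,u)=\frac{k+1}{n+1}\binom{2n-k}{n},$$ $$[z^n][u^k]F(u,z)=\frac{k}{n}\binom{2n-k-1}{n-1},$$ $$[z^n][u^k]G(u,z)=\frac{k+3}{n+1}\binom{2n-k-2}{n},$$ $$[z^n][u^k]H(u,z)=\frac{k+1}{n}\binom{2n-k-2}{n-1}.$$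
   Context: A partial Łukasiewicz path read from right to left, of length $n\ge0$, is a lattice path starting at $(0,0)$, consisting of $n$ steps from $\{(1,j): j\in\mathbb{Z},\ j\le 1\}$, and never going below the $x$-axis. The height of a point is its $y$-coordinate. The step $(1,1)$ is an up-step, $(1,0)$ is a horizontal step, and $(1,-j)$ with $j\ge 1$ is a down-step. $F(u,z)=\sum_{k\ge0}u^kf_k(z)$, $G(u,z)=\sum_{k\ge0}u^kg_k(z)$, $H(u,z)=\sum_{k\ge0}u^kh_k(z)$, where the coefficient of $z^n$ in $f_k$ (resp. $g_k$, $h_k$) is the number of such paths of length $n$ ending at height $k$ whose last step is an up-step (resp. a down-step, a horizontal step). The empty path is counted in $f_0$, so $f_0=1$. $\mathit{Total}=F+G+H$ counts all such paths. $\sqrt{1-4z}$ is the formal power series with constant term $1$. $[x^m]$ denotes coefficient extraction. Convention: $\binom{a}{b}=0$ unless $0\le b\le a$. *)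

theory Defs
  imports "HOL-Computational_Algebra.Formal_Power_Series"
begin

unbundle fps_syntax

text \<open>A lattice path starting at \<open>(0, 0)\<close> is the list of its steps.\<close>

type_synonym path = "(int \<times> int) list"

definition height :: "path \<Rightarrow> int" where
  "height p = sum_list (map snd p)"

text \<open>The points of a path are the end points of its prefixes.\<close>

definition luk_path :: "path \<Rightarrow> bool" where
  "luk_path p \<longleftrightarrow>
     set p \<subseteq> {(1, j) | j. j \<le> 1} \<and> (\<forall>i\<le>length p. 0 \<le> height (take i p))"

definition luk_paths :: "nat \<Rightarrow> nat \<Rightarrow> path set" where
  "luk_paths n k = {p. luk_path p \<and> length p = n \<and> height p = int k}"

text \<open>
  A bivariate series is a series in \<open>u\<close> whose coefficients are series in \<open>z\<close>: the coefficient of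
  \<open>u\<^sup>k z\<^sup>n\<close> in \<open>X\<close> is \<open>X $ k $ n\<close>.
\<close>

definition var_u :: "real fps fps" where
  "var_u = fps_X"

definition var_z :: "real fps fps" where
  "var_z = fps_const fps_X"

definition path_gf :: "(path \<Rightarrow> bool) \<Rightarrow> real fps fps" where
  "path_gf P = Abs_fps (\<lambda>k. Abs_fps (\<lambda>n. real (card {p \<in> luk_paths n k. P p})))"

text \<open>The empty path is counted in \<open>F_gf\<close>.\<close>

definition F_gf :: "real fps fps" where
  "F_gf = path_gf (\<lambda>p. p = [] \<or> last p = (1, 1))"

definition G_gf :: "real fps fps" where
  "G_gf = path_gf (\<lambda>p. p \<noteq> [] \<and> (\<exists>j\<ge>1. last p = (1, - j)))"

definition H_gf :: "real fps fps" where
  "H_gf = path_gf (\<lambda>p. p \<noteq> [] \<and> last p = (1, 0))"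

definition Total_gf :: "real fps fps" where
  "Total_gf = F_gf + G_gf + H_gf"

definition sqrt_1_4z :: "real fps" where
  "sqrt_1_4z = fps_radical root 2 (1 - 4 * fps_X)"

text \<open>
  The numerator has zero constant term, so this division is exact (see \<open>L_gf_mult\<close> below).
\<close>

definition L_gf :: "real fps" where
  "L_gf = (1 - sqrt_1_4z) / (2 * fps_X)"

text \<open>
  Binomial coefficients with integer arguments, zero unless \<open>0 \<le> b \<le> a\<close>. Integers are needed
  because upper arguments such as \<open>2 n - k - 2\<close> may be negative.
\<close>

definition ibinom :: "int \<Rightarrow> int \<Rightarrow> nat" where
  "ibinom a b = (if 0 \<le> b \<and> b \<le> a then nat a choose nat b else 0)"


text \<open>The cardinalities used in \<open>path_gf\<close> are those of finite sets.\<close>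

lemma height_le: "luk_path p \<Longrightarrow> height p \<le> int (length p)"
proof -
  assume "luk_path p"
  then have "\<forall>s\<in>set p. snd s \<le> 1" by (auto simp: luk_path_def)
  then show ?thesis by (induction p) (auto simp: height_def)
qed

lemma luk_path_take: "luk_path p \<Longrightarrow> luk_path (take i p)"
  unfolding luk_path_def using set_take_subset[of i p] by (auto simp: min_def)

lemma finite_luk_paths: "finite (luk_paths n k)"
proof (rule finite_subset)
  show "luk_paths n k \<subseteq> {p. set p \<subseteq> {1} \<times> {- int n..1} \<and> length p = n}"
  proof
    fix p assume "p \<in> luk_paths n k"
    then have p: "luk_path p" and len: "length p = n" by (auto simp: luk_paths_def)
    have "p ! i \<in> {1} \<times> {- int n..1}" if i: "i < n" for i
    proof -
      have "p ! i \<in> {(1, j) | j. j \<le> 1}"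
        using p i len nth_mem[of i p] unfolding luk_path_def by blast
      moreover have "0 \<le> height (take (Suc i) p)"
        using p i len by (simp add: luk_path_def)
      moreover have "height (take (Suc i) p) = height (take i p) + snd (p ! i)"
        using i len by (simp add: take_Suc_conv_app_nth height_def)
      moreover have "height (take i p) \<le> int i"
        using height_le[OF luk_path_take[OF p, of i]] i len by simp
      ultimately show ?thesis using i by auto
    qed
    then have "set p \<subseteq> {1} \<times> {- int n..1}"
      using len by (metis in_set_conv_nth subsetI)
    then show "p \<in> {p. set p \<subseteq> {1} \<times> {- int n..1} \<and> length p = n}"
      using len by simp
  qed
  show "finite {p. set p \<subseteq> {1} \<times> {- int n..1::int} \<and> length p = n}"
    by (rule finite_lists_length_eq) simp
qed

lemma Total_gf_eq: "Total_gf = path_gf (\<lambda>_. True)"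
proof (intro fps_ext)
  fix k n
  let ?F = "{p \<in> luk_paths n k. p = [] \<or> last p = (1, 1)}"
  let ?G = "{p \<in> luk_paths n k. p \<noteq> [] \<and> (\<exists>j\<ge>1. last p = (1, - j))}"
  let ?H = "{p \<in> luk_paths n k. p \<noteq> [] \<and> last p = (1, 0)}"
  have fin: "finite ?F" "finite ?G" "finite ?H"
    by (auto intro: finite_subset[OF _ finite_luk_paths[of n k]])
  have last_step: "last p = (1, 1) \<or> last p = (1, 0) \<or> (\<exists>j\<ge>1. last p = (1, - j))"
    if p: "p \<in> luk_paths n k" "p \<noteq> []" for p
  proof -
    have "last p \<in> {(1, j) | j. j \<le> 1}"
      using p last_in_set[of p] unfolding luk_paths_def luk_path_def by blast
    then obtain j where j: "last p = (1, j)" "j \<le> 1" by auto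
    show ?thesis
    proof (cases "j \<ge> 0")
      case True
      then have "j = 0 \<or> j = 1" using j by linarith
      then show ?thesis using j by auto
    next
      case False
      then have "- j \<ge> 1 \<and> last p = (1, - (- j))" using j by simp
      then show ?thesis by blast
    qed
  qed
  have "luk_paths n k = ?F \<union> ?G \<union> ?H"
    using last_step by blast
  moreover have "card (?F \<union> ?G \<union> ?H) = card (?F \<union> ?G) + card ?H"
    using fin by (intro card_Un_disjoint) auto
  moreover have "card (?F \<union> ?G) = card ?F + card ?G"
    using fin by (intro card_Un_disjoint) auto
  ultimately have "card (luk_paths n k) = card ?F + card ?G + card ?H" by simp
  then show "Total_gf $ k $ n = path_gf (\<lambda>_. True) $ k $ n"
    by (simp add: Total_gf_def F_gf_def G_gf_def H_gf_def path_gf_def)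
qed

lemma sqrt_1_4z_square: "sqrt_1_4z ^ 2 = 1 - 4 * fps_X"
  using power_radical[of "1 - 4 * fps_X :: real fps" root 1]
  by (simp add: sqrt_1_4z_def numeral_2_eq_2)

lemma sqrt_1_4z_nth_0: "sqrt_1_4z $ 0 = 1"
  by (simp add: sqrt_1_4z_def)

lemma L_gf_mult: "2 * fps_X * L_gf = 1 - sqrt_1_4z"
proof -
  define A where "A = fps_shift 1 (1 - sqrt_1_4z)"
  have two: "2 * fps_const (1/2 :: real) = 1"
    by (simp add: numeral_fps_const)
  have "1 - sqrt_1_4z = fps_X * A"
    by (rule fps_ext) (simp add: A_def sqrt_1_4z_nth_0)
  also have "\<dots> = (2 * fps_const (1/2)) * (fps_X * A)"
    by (simp only: two mult_1)
  also have "\<dots> = 2 * fps_X * (fps_const (1/2) * A)"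
    by (simp only: ac_simps)
  finally have "2 * fps_X dvd 1 - sqrt_1_4z"
    by (rule dvdI)
  then show ?thesis by (simp add: L_gf_def)
qed

text \<open>The denominator in the closed form of \<open>Total_gf\<close> is a unit, so the quotient is genuine.\<close>

lemma Total_denominator:
  fixes D :: "real fps fps"
  defines "D \<equiv> 1 - 2 * var_z * var_u + fps_const sqrt_1_4z"
  shows "D * (2 / D) = 2"
proof -
  have D0: "D $ 0 = 1 + sqrt_1_4z"
    by (simp add: D_def var_u_def)
  have D00: "D $ 0 $ 0 \<noteq> 0"
    by (simp add: D0 sqrt_1_4z_nth_0)
  then have "D $ 0 \<noteq> 0" by auto
  then have sub: "subdegree D = 0" by simp
  have "D $ 0 * inverse (D $ 0) = 1"
    using D00 by (rule inverse_mult_eq_1')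
  then have "D * inverse D = 1"
    unfolding fps_inverse_def[of D] by (rule fps_right_inverse)
  moreover have "2 / D = 2 * inverse D"
    using sub by (simp add: fps_divide_def)
  ultimately show ?thesis
    by (simp add: mult.left_commute)
qed

end

theory Submission
  imports Defs
begin

text \<open>
  Write \<open>t n k\<close> for the number of paths of length \<open>n\<close> ending at height \<open>k\<close>. Deleting the last step
  of a nonempty path loses no information once the final height is known: the deleted step is the
  difference between that height and the height of the remaining path. Hence the paths of length
  \<open>n + 1\<close> ending at \<open>k\<close> correspond to the paths of length \<open>n\<close> ending at any height \<open>\<ge> k - 1\<close>, and
  conditions on the last step become conditions on the height of the shortened path. An up-step
  means height \<open>k - 1\<close>, a horizontal step height \<open>k\<close>, and a down-step height \<open>\<ge> k + 1\<close>. The last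
  condition is also the one that describes \<^emph>\<open>all\<close> paths of length \<open>n + 1\<close> ending at \<open>k + 2\<close>. So the
  three refined counts at \<open>n + 1\<close> and \<open>k\<close> are \<open>t n (k - 1)\<close>, \<open>t n k\<close> and \<open>t (n + 1) (k + 2)\<close>, and
  everything reduces to \<open>t\<close>.

  Splitting the heights \<open>\<ge> k - 1\<close> into \<open>k - 1\<close> and the heights \<open>\<ge> k\<close> gives
  \<open>t (n + 1) k = t n (k - 1) + t (n + 1) (k + 1)\<close>, without the first summand when \<open>k = 0\<close>. As \<open>t n k\<close>
  vanishes for \<open>k > n\<close>, the recurrence and the row \<open>n = 0\<close> determine \<open>t\<close>: each row is computed from the previous
  one, starting at the right end (\<open>ballot_array_unique\<close>). It remains to exhibit two other solutions.
  The coefficients of \<open>z\<^sup>k L\<^sup>k\<^sup>+\<^sup>1\<close> form one, since \<open>L = 1 + z L\<^sup>2\<close>. The ballot numbers, written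
  as \<open>binom (2 n - k) n - binom (2 n - k) (n + 1)\<close>, form another, since then the recurrence is Pascal's
  rule. The closed form of the bivariate series is the geometric series
  \<open>L / (1 - u z L)\<close>, because \<open>1 + \<surd>(1 - 4 z) = 2 / L\<close>.
\<close>

section \<open>The ballot recurrence\<close>

definition ballot_array :: "(nat \<Rightarrow> nat \<Rightarrow> real) \<Rightarrow> bool" where
  "ballot_array a \<longleftrightarrow>
     (\<forall>k. a 0 k = (if k = 0 then 1 else 0)) \<and>
     (\<forall>n k. n < k \<longrightarrow> a n k = 0) \<and>
     (\<forall>n. a (Suc n) 0 = a (Suc n) 1) \<and>
     (\<forall>n k. a (Suc n) (Suc k) = a (Suc n) (Suc (Suc k)) + a n k)"

text \<open>
  The recurrence expresses an entry by its right neighbour and by an entry of the previous row, so a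
  row is filled in from its right end, where it is zero.
\<close>

lemma ballot_array_unique:
  assumes "ballot_array a" and "ballot_array b"
  shows "a n k = b n k"
proof (induction n arbitrary: k)
  case 0
  then show ?case using assms by (simp add: ballot_array_def)
next
  case (Suc n)
  note row = Suc.IH
  have pos: "a (Suc n) (Suc k) = b (Suc n) (Suc k)" for k
  proof (induction "Suc n - k" arbitrary: k)
    case 0
    then have "Suc n < Suc k" by simp
    then have "a (Suc n) (Suc k) = 0" "b (Suc n) (Suc k) = 0"
      using assms unfolding ballot_array_def by blast+
    then show ?case by simp
  next
    case (Suc m)
    then have "m = Suc n - Suc k" by linarith
    then have "a (Suc n) (Suc (Suc k)) = b (Suc n) (Suc (Suc k))" by (rule Suc.hyps(1))
    moreover have "a n k = b n k" by (rule row)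
    moreover have "a (Suc n) (Suc k) = a (Suc n) (Suc (Suc k)) + a n k"
      "b (Suc n) (Suc k) = b (Suc n) (Suc (Suc k)) + b n k"
      using assms unfolding ballot_array_def by blast+
    ultimately show ?case by simp
  qed
  show ?case
  proof (cases k)
    case 0
    have "a (Suc n) 0 = a (Suc n) 1" "b (Suc n) 0 = b (Suc n) 1"
      using assms unfolding ballot_array_def by blast+
    then show ?thesis using 0 pos[of 0] by simp
  next
    case (Suc j)
    then show ?thesis using pos by simp
  qed
qed

section \<open>Counting paths by their last step\<close>

lemma height_snoc: "height (p @ [s]) = height p + snd s"
  by (simp add: height_def)

lemma luk_path_height_nonneg: "luk_path p \<Longrightarrow> 0 \<le> height p"
  by (metis luk_path_def order_refl take_all)

lemma luk_path_snoc:
  "luk_path (p @ [s]) \<longleftrightarrow> luk_path p \<and> fst s = 1 \<and> snd s \<le> 1 \<and> 0 \<le> height (p @ [s])"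
  by (cases s) (auto simp: luk_path_def le_Suc_eq)

text \<open>
  The last step is recovered from the rest of the path and the final height, so appending it is
  injective on the shortened paths.
\<close>

lemma card_luk_paths_last:
  "card {p \<in> luk_paths (Suc n) k. Q (last p)} =
   card {q. luk_path q \<and> length q = n \<and> int k \<le> height q + 1 \<and> Q (1, int k - height q)}"
    (is "card ?P = card ?R")
proof -
  let ?f = "\<lambda>q. q @ [(1, int k - height q)]"
  have "?P \<subseteq> ?f ` ?R"
  proof
    fix p assume p: "p \<in> ?P"
    then have "length p = Suc n" by (simp add: luk_paths_def)
    then obtain q s where q: "p = q @ [s]" by (metis length_Suc_conv_rev)
    have h: "height q + snd s = int k"
      using p by (simp add: q luk_paths_def height_snoc)
    have luk: "luk_path q" "fst s = 1" "snd s \<le> 1"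
      using p by (simp_all add: q luk_paths_def luk_path_snoc)
    have s: "s = (1, int k - height q)"
      using h luk(2) by (simp add: prod_eq_iff)
    have "q \<in> ?R"
      using p h luk s by (simp add: q luk_paths_def)
    then show "p \<in> ?f ` ?R" using q s by blast
  qed
  moreover have "?f ` ?R \<subseteq> ?P"
    by (auto simp: luk_paths_def luk_path_snoc height_snoc)
  ultimately have "?P = ?f ` ?R" by blast
  moreover have "inj_on ?f ?R" by (rule inj_onI) simp
  ultimately show ?thesis by (simp add: card_image)
qed

lemma card_luk_paths_Suc:
  "card (luk_paths (Suc n) k) = card {q. luk_path q \<and> length q = n \<and> int k \<le> height q + 1}"
  using card_luk_paths_last[of n k "\<lambda>_. True"] by simp

lemma card_luk_paths_last_up:
  "card {p \<in> luk_paths (Suc n) k. last p = (1, 1)} =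
   (if k = 0 then 0 else card (luk_paths n (k - 1)))"
proof -
  have "{q. luk_path q \<and> length q = n \<and> int k \<le> height q + 1 \<and> (1, int k - height q) = (1::int, 1)}
      = (if k = 0 then {} else luk_paths n (k - 1))"
    by (cases k) (auto simp: luk_paths_def dest: luk_path_height_nonneg)
  then show ?thesis
    using card_luk_paths_last[of n k "\<lambda>s. s = (1, 1)"]
    by (simp only: if_distrib[of card] card.empty)
qed

lemma card_luk_paths_last_horizontal:
  "card {p \<in> luk_paths (Suc n) k. last p = (1, 0)} = card (luk_paths n k)"
proof -
  have "{q. luk_path q \<and> length q = n \<and> int k \<le> height q + 1 \<and> (1, int k - height q) = (1::int, 0)}
      = luk_paths n k"
    by (auto simp: luk_paths_def)
  then show ?thesis
    using card_luk_paths_last[of n k "\<lambda>s. s = (1, 0)"] by (simp only:)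
qed

text \<open>
  Raising the last step by two turns the paths ending at \<open>k\<close> with a down-step into all paths ending
  at \<open>k + 2\<close>.
\<close>

lemma card_luk_paths_last_down:
  "card {p \<in> luk_paths (Suc n) k. \<exists>j\<ge>1. last p = (1, - j)} = card (luk_paths (Suc n) (k + 2))"
proof -
  have down: "(\<exists>j\<ge>1. (1::int, int k - h) = (1, - j)) \<longleftrightarrow> int k + 1 \<le> h" for h
    by (auto intro: exI[of _ "h - int k"])
  have "{q. luk_path q \<and> length q = n \<and> int k \<le> height q + 1 \<and>
          (\<exists>j\<ge>1. (1::int, int k - height q) = (1, - j))}
      = {q. luk_path q \<and> length q = n \<and> int (k + 2) \<le> height q + 1}"
    unfolding down by auto
  then show ?thesis
    using card_luk_paths_last[of n k "\<lambda>s. \<exists>j\<ge>1. s = (1, - j)"] card_luk_paths_Suc[of n "k + 2"]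
    by simp
qed

lemma ballot_array_luk_paths: "ballot_array (\<lambda>n k. real (card (luk_paths n k)))"
  unfolding ballot_array_def
proof (intro conjI allI impI)
  fix k
  have "luk_paths 0 k = (if k = 0 then {[]} else {})"
    by (auto simp: luk_paths_def luk_path_def height_def)
  then show "real (card (luk_paths 0 k)) = (if k = 0 then 1 else 0)" by simp
next
  fix n k :: nat
  assume "n < k"
  then have "luk_paths n k = {}"
    using height_le by (force simp: luk_paths_def)
  then show "real (card (luk_paths n k)) = 0" by simp
next
  fix n
  (* Prefixes have nonnegative height, so the bounds -1 and 0 admit the same ones. *)
  have "{q. luk_path q \<and> length q = n \<and> int 0 \<le> height q + 1}
      = {q. luk_path q \<and> length q = n \<and> int 1 \<le> height q + 1}"
    using luk_path_height_nonneg by force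
  then show "real (card (luk_paths (Suc n) 0)) = real (card (luk_paths (Suc n) 1))"
    by (simp add: card_luk_paths_Suc)
next
  fix n k
  let ?R = "\<lambda>k. {q. luk_path q \<and> length q = n \<and> int k \<le> height q + 1}"
  have split: "?R (Suc k) = ?R (Suc (Suc k)) \<union> luk_paths n k"
    by (auto simp: luk_paths_def)
  have "?R (Suc (Suc k)) \<subseteq> (\<Union>i\<le>n. luk_paths n i)"
  proof
    fix q assume q: "q \<in> ?R (Suc (Suc k))"
    then have "height q \<le> int n" "0 \<le> height q"
      using height_le[of q] luk_path_height_nonneg[of q] by auto
    then have "q \<in> luk_paths n (nat (height q))" "nat (height q) \<le> n"
      using q by (auto simp: luk_paths_def)
    then show "q \<in> (\<Union>i\<le>n. luk_paths n i)" by blast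
  qed
  then have "finite (?R (Suc (Suc k)))"
    by (rule finite_subset) (simp add: finite_luk_paths)
  moreover have "?R (Suc (Suc k)) \<inter> luk_paths n k = {}"
    by (auto simp: luk_paths_def)
  ultimately have "card (?R (Suc k)) = card (?R (Suc (Suc k))) + card (luk_paths n k)"
    unfolding split by (intro card_Un_disjoint finite_luk_paths)
  then show "real (card (luk_paths (Suc n) (Suc k)))
      = real (card (luk_paths (Suc n) (Suc (Suc k)))) + real (card (luk_paths n k))"
    by (simp only: card_luk_paths_Suc of_nat_add)
qed

section \<open>Powers of the Catalan series\<close>

text \<open>
  Substituting \<open>\<surd>(1 - 4 z) = 1 - 2 z L\<close> into its square gives the quadratic equation of the Catalan
  series, multiplied by \<open>4 z\<close>.
\<close>

lemma L_gf_quadratic: "L_gf = 1 + fps_X * L_gf ^ 2"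
proof -
  have s: "sqrt_1_4z = 1 - 2 * fps_X * L_gf"
    using L_gf_mult by simp
  have "(1 - 2 * fps_X * L_gf) ^ 2 = 1 - 4 * fps_X"
    using sqrt_1_4z_square s by simp
  then have "(4 * fps_X) * (1 + fps_X * L_gf ^ 2 - L_gf) = 0"
    by (simp add: power2_eq_square algebra_simps)
  moreover have "4 * fps_X \<noteq> (0 :: real fps)"
    by simp
  ultimately have "1 + fps_X * L_gf ^ 2 - L_gf = 0"
    by (simp only: mult_eq_0_iff) simp
  then show ?thesis by simp
qed

lemma ballot_array_L_gf: "ballot_array (\<lambda>n k. (fps_X ^ k * L_gf ^ (k + 1)) $ n)"
  unfolding ballot_array_def
proof (intro conjI allI impI)
  have "L_gf $ 0 = (1 + fps_X * L_gf ^ 2) $ 0"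
    using L_gf_quadratic by (rule arg_cong)
  then have "L_gf $ 0 = 1" by simp
  then show "(fps_X ^ k * L_gf ^ (k + 1)) $ 0 = (if k = 0 then 1 else 0)" for k
    by (simp add: fps_X_power_mult_nth)
next
  fix n k :: nat
  assume "n < k"
  then show "(fps_X ^ k * L_gf ^ (k + 1)) $ n = 0"
    by (simp add: fps_X_power_mult_nth)
next
  fix n
  have "L_gf $ Suc n = (1 + fps_X * L_gf ^ 2) $ Suc n"
    using L_gf_quadratic by (rule arg_cong)
  then show "(fps_X ^ 0 * L_gf ^ (0 + 1)) $ Suc n = (fps_X ^ 1 * L_gf ^ (1 + 1)) $ Suc n"
    by (simp add: numeral_2_eq_2)
next
  fix n k
  have "fps_X ^ Suc k * L_gf ^ (Suc k + 1) = fps_X ^ Suc k * L_gf ^ Suc k * L_gf"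
    by (simp add: algebra_simps)
  also have "\<dots> = fps_X ^ Suc k * L_gf ^ Suc k * (1 + fps_X * L_gf ^ 2)"
    using L_gf_quadratic by simp
  also have "\<dots> = fps_X ^ Suc (Suc k) * L_gf ^ (Suc (Suc k) + 1)
      + fps_X * (fps_X ^ k * L_gf ^ (k + 1))"
    by (simp add: algebra_simps power2_eq_square)
  finally have "(fps_X ^ Suc k * L_gf ^ (Suc k + 1)) $ Suc n
      = (fps_X ^ Suc (Suc k) * L_gf ^ (Suc (Suc k) + 1)
         + fps_X * (fps_X ^ k * L_gf ^ (k + 1))) $ Suc n"
    by (rule arg_cong)
  also have "\<dots> = (fps_X ^ Suc (Suc k) * L_gf ^ (Suc (Suc k) + 1)) $ Suc n
      + (fps_X ^ k * L_gf ^ (k + 1)) $ n"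
    by (simp only: fps_add_nth fps_X_mult_nth) simp
  finally show "(fps_X ^ Suc k * L_gf ^ (Suc k + 1)) $ Suc n
      = (fps_X ^ Suc (Suc k) * L_gf ^ (Suc (Suc k) + 1)) $ Suc n
      + (fps_X ^ k * L_gf ^ (k + 1)) $ n" .
qed

section \<open>Ballot numbers\<close>

text \<open>
  With entries zero outside \<open>0 \<le> b \<le> a\<close>, Pascal's rule fails only at \<open>a = b = - 1\<close>, where it would
  make the apex \<open>ibinom 0 0 = 1\<close> a sum of zeros; the hypothesis keeps away from that point.
\<close>

lemma ibinom_Pascal:
  assumes "0 \<le> b"
  shows "ibinom (a + 1) (b + 1) = ibinom a b + ibinom a (b + 1)"
proof (cases "b \<le> a")
  case True
  then have "nat (a + 1) = Suc (nat a)" "nat (b + 1) = Suc (nat b)"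
    using assms by (simp_all add: nat_add_distrib)
  then show ?thesis using True assms by (auto simp: ibinom_def binomial_eq_0)
next
  case False
  then show ?thesis by (simp add: ibinom_def)
qed

lemma ibinom_of_nat: "ibinom (int m) (int j) = m choose j"
  by (simp add: ibinom_def binomial_eq_0)

text \<open>
  As a difference of two binomial coefficients in the same row, the ballot number obeys its
  recurrence term by term, by Pascal's rule.
\<close>

definition ballot_number :: "nat \<Rightarrow> nat \<Rightarrow> real" where
  "ballot_number n k =
     real (ibinom (2 * int n - int k) (int n)) - real (ibinom (2 * int n - int k) (int n + 1))"

lemma ballot_number_closed_form:
  "ballot_number n k = real (k + 1) / real (n + 1) * real (ibinom (2 * int n - int k) (int n))"
proof (cases "k \<le> n")
  case True
  define N where "N = 2 * n - k"
  have N: "2 * int n - int k = int N" "N - n = n - k"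
    using True by (simp_all add: N_def)
  have "Suc n * (N choose Suc n) = (N - n) * (N choose n)"
    using binomial_absorb_comp[of N n] binomial_absorption[of n N] by simp
  then have "real (n + 1) * real (N choose Suc n) = (real n - real k) * real (N choose n)"
    unfolding N(2) using True by (metis Suc_eq_plus1 of_nat_diff of_nat_mult)
  moreover have "ibinom (int N) (int n + 1) = N choose Suc n"
    using ibinom_of_nat[of N "Suc n"] by (simp add: add.commute)
  ultimately show ?thesis
    unfolding ballot_number_def N(1) by (simp add: ibinom_of_nat field_simps)
next
  case False
  then show ?thesis by (simp add: ballot_number_def ibinom_def)
qed

lemma ballot_array_ballot_number: "ballot_array ballot_number"
  unfolding ballot_array_def
proof (intro conjI allI impI)
  show "ballot_number 0 k = (if k = 0 then 1 else 0)" for k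
    by (simp add: ballot_number_def ibinom_def)
next
  fix n k :: nat
  assume "n < k"
  then show "ballot_number n k = 0"
    by (simp add: ballot_number_def ibinom_def)
next
  fix n
  (* Pascal's rule reduces the first column to the equality of the two central entries of row ?N. *)
  let ?N = "2 * int n + 1"
  have "(2 * n + 1) choose n = (2 * n + 1) choose Suc n"
    using binomial_symmetric[of n "2 * n + 1"] by simp
  then have "ibinom ?N (int n) = ibinom ?N (int n + 1)"
    using ibinom_of_nat[of "2 * n + 1" n] ibinom_of_nat[of "2 * n + 1" "Suc n"]
    by (simp add: add.commute)
  then show "ballot_number (Suc n) 0 = ballot_number (Suc n) 1"
    using ibinom_Pascal[of "int n" ?N] ibinom_Pascal[of "int n + 1" ?N]
    by (simp add: ballot_number_def algebra_simps)
next
  fix n k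
  let ?N = "2 * int n - int k"
  show "ballot_number (Suc n) (Suc k) = ballot_number (Suc n) (Suc (Suc k)) + ballot_number n k"
    using ibinom_Pascal[of "int n" ?N] ibinom_Pascal[of "int n + 1" ?N]
    by (simp add: ballot_number_def algebra_simps)
qed

section \<open>The generating functions\<close>

lemma Total_gf_nth: "Total_gf $ k $ n = real (card (luk_paths n k))"
  by (simp add: Total_gf_eq path_gf_def)

lemma Total_gf_ballot_number: "Total_gf $ k $ n = ballot_number n k"
  unfolding Total_gf_nth
  by (rule ballot_array_unique[OF ballot_array_luk_paths ballot_array_ballot_number])

lemma Total_gf_nth_L_gf: "Total_gf $ k = fps_X ^ k * L_gf ^ (k + 1)"
proof (rule fps_ext)
  fix n
  show "Total_gf $ k $ n = (fps_X ^ k * L_gf ^ (k + 1)) $ n"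
    unfolding Total_gf_nth
    by (rule ballot_array_unique[OF ballot_array_luk_paths ballot_array_L_gf])
qed

lemma F_gf_Suc: "F_gf $ k $ Suc n = (if k = 0 then 0 else Total_gf $ (k - 1) $ n)"
proof -
  have "{p \<in> luk_paths (Suc n) k. p = [] \<or> last p = (1, 1)}
      = {p \<in> luk_paths (Suc n) k. last p = (1, 1)}"
    by (auto simp: luk_paths_def)
  then show ?thesis
    by (simp add: F_gf_def path_gf_def Total_gf_nth card_luk_paths_last_up)
qed

lemma G_gf_Suc: "G_gf $ k $ Suc n = Total_gf $ (k + 2) $ Suc n"
proof -
  have "{p \<in> luk_paths (Suc n) k. p \<noteq> [] \<and> (\<exists>j\<ge>1. last p = (1, - j))}
      = {p \<in> luk_paths (Suc n) k. \<exists>j\<ge>1. last p = (1, - j)}"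
    by (auto simp: luk_paths_def)
  then show ?thesis
    by (simp add: G_gf_def path_gf_def Total_gf_nth card_luk_paths_last_down)
qed

lemma H_gf_Suc: "H_gf $ k $ Suc n = Total_gf $ k $ n"
proof -
  have "{p \<in> luk_paths (Suc n) k. p \<noteq> [] \<and> last p = (1, 0)}
      = {p \<in> luk_paths (Suc n) k. last p = (1, 0)}"
    by (auto simp: luk_paths_def)
  then show ?thesis
    by (simp add: H_gf_def path_gf_def Total_gf_nth card_luk_paths_last_horizontal)
qed

text \<open>
  The denominator is \<open>2 (1 - z L) - 2 z u\<close>, and \<open>L (1 - z L) = 1\<close>; so multiplying it with the
  geometric series \<open>\<Sum>u\<^sup>k z\<^sup>k L\<^sup>k\<^sup>+\<^sup>1\<close> telescopes to \<open>2\<close>.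
\<close>

lemma Total_gf_closed_form: "Total_gf = 2 / (1 - 2 * var_z * var_u + fps_const sqrt_1_4z)"
proof -
  define D :: "real fps fps" where "D = 1 - 2 * var_z * var_u + fps_const sqrt_1_4z"
  have D: "D = fps_const (1 + sqrt_1_4z) - fps_const (2 * fps_X) * fps_X"
    by (simp add: D_def var_z_def var_u_def numeral_fps_const
        flip: fps_const_mult fps_const_add)
  have "1 + sqrt_1_4z = 2 - 2 * fps_X * L_gf"
    using L_gf_mult by (simp add: algebra_simps)
  moreover have "(2 - 2 * fps_X * L_gf) * L_gf = 2 * (L_gf - fps_X * L_gf ^ 2)"
    by (simp add: algebra_simps power2_eq_square)
  moreover have "L_gf - fps_X * L_gf ^ 2 = 1"
    using L_gf_quadratic by (metis add_diff_cancel_right')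
  ultimately have unit: "(1 + sqrt_1_4z) * L_gf = 2" by (simp only: mult_1_right)
  have "D * Total_gf = 2"
  proof (rule fps_ext)
    fix k
    show "(D * Total_gf) $ k = 2 $ k"
    proof (cases k)
      case 0
      then show ?thesis
        using unit by (simp add: D algebra_simps Total_gf_nth_L_gf)
    next
      case (Suc j)
      have "(D * Total_gf) $ Suc j
          = (1 + sqrt_1_4z) * Total_gf $ Suc j - 2 * fps_X * Total_gf $ j"
        by (simp add: D left_diff_distrib mult.assoc del: fps_const_add fps_const_mult)
      also have "\<dots> = fps_X ^ Suc j * L_gf ^ Suc j * ((1 + sqrt_1_4z) * L_gf - 2)"
        by (simp add: Total_gf_nth_L_gf algebra_simps)
      also have "\<dots> = 0" by (simp add: unit)
      finally show ?thesis by (simp add: Suc fps_numeral_nth)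
    qed
  qed
  also have "2 = D * (2 / D)"
    unfolding D_def by (rule Total_denominator[symmetric])
  finally have "D * Total_gf = D * (2 / D)" .
  moreover have "D \<noteq> 0"
    using \<open>D * Total_gf = 2\<close> by auto
  ultimately show ?thesis by (simp add: D_def)
qed

theorem theorem2:
  shows "Total_gf = 2 / (1 - 2 * var_z * var_u + fps_const sqrt_1_4z)
    \<and> (\<forall>k. Total_gf $ k = fps_X ^ k * L_gf ^ (k + 1))
    \<and> (\<forall>n k. n \<ge> 1 \<longrightarrow>
         Total_gf $ k $ n
           = real (k + 1) / real (n + 1) * real (ibinom (2 * int n - int k) (int n))
       \<and> F_gf $ k $ n
           = real k / real n * real (ibinom (2 * int n - int k - 1) (int n - 1))
       \<and> G_gf $ k $ n
           = real (k + 3) / real (n + 1) * real (ibinom (2 * int n - int k - 2) (int n))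
       \<and> H_gf $ k $ n
           = real (k + 1) / real n * real (ibinom (2 * int n - int k - 2) (int n - 1)))"
proof (intro conjI allI impI)
  show "Total_gf = 2 / (1 - 2 * var_z * var_u + fps_const sqrt_1_4z)"
    by (rule Total_gf_closed_form)
  show "Total_gf $ k = fps_X ^ k * L_gf ^ (k + 1)" for k
    by (rule Total_gf_nth_L_gf)
next
  fix n k :: nat
  assume "n \<ge> 1"
  then obtain m where n: "n = Suc m" by (cases n) auto
  show "Total_gf $ k $ n
      = real (k + 1) / real (n + 1) * real (ibinom (2 * int n - int k) (int n))"
    by (simp only: Total_gf_ballot_number ballot_number_closed_form)
  show "F_gf $ k $ n
      = real k / real n * real (ibinom (2 * int n - int k - 1) (int n - 1))"
    by (cases k) (simp_all add: n F_gf_Suc Total_gf_ballot_number ballot_number_closed_form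
        algebra_simps)
  show "G_gf $ k $ n
      = real (k + 3) / real (n + 1) * real (ibinom (2 * int n - int k - 2) (int n))"
    unfolding n G_gf_Suc Total_gf_ballot_number ballot_number_closed_form
    by (simp add: algebra_simps)
  show "H_gf $ k $ n
      = real (k + 1) / real n * real (ibinom (2 * int n - int k - 2) (int n - 1))"
    by (simp add: n H_gf_Suc Total_gf_ballot_number ballot_number_closed_form)
qed

end
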